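(* Let $F, G, H \colon \mathbf{Set} \to \mathbf{Set}$ be taut functors. Then: (1) (associativity) The two composites $$\gamma_{H, G\circ F} \cdot (\mathrm{id} \times \gamma_{G,F}) \quad\text{and}\quad \gamma_{H \circ G, F} \cdot \bigl((\gamma_{H,G} \circ F) \times \mathrm{id}\bigr)$$ from $(\Delta[H] \circ G \circ F) \times (\Delta[G] \circ F) \times \Delta[F]$ to $\Delta[H \circ G \circ F]$ are equal. (2) Under the identification $\Delta[\mathrm{Id}] = 1$, the transformation $\gamma_{\mathrm{Id}, F} \colon (\Delta[\mathrm{Id}] \circ F) \times \Delta[F] \to \Delta[\mathrm{Id} \circ F] = \Delta[F]$ is the canonical isomorphism $1 \times \Delta[F] \cong \Delta[F]$. (3) Under the identification $\Delta[\mathrm{Id}] = 1$, the transformation $\gamma_{F, \mathrm{Id}} \colon (\Delta[F] \circ \mathrm{Id}) \times \Delta[\mathrm{Id}] \to \Delta[F \circ \mathrm{Id}] = \Delta[F]$ is the canonical isomorphism $\Delta[F] \times 1 \cong \Delta[F]$.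
   Context: A functor is taut if it preserves inverse image diagrams, i.e. pullback squares in which one leg is a monomorphism (pullbacks of a monomorphism along an arbitrary morphism). Taut functors preserve monomorphisms, and composites of taut functors are taut. For a taut functor $F \colon \mathbf{Set} \to \mathbf{Set}$ let $j_X \colon X \to X+1$ be the coproduct injection. The difference functor of $F$ is $\Delta[F](X) = F(X+1) \setminus \mathrm{Im}\, F(j_X)$; for $f \colon X \to Y$, $\Delta[F](f)$ is the restriction of $F(f+1)$ (which does restrict, because $F$ is taut). It is a taut functor. $\mathrm{Id}$ is the identity functor of $\mathbf{Set}$; $\Delta[\mathrm{Id}](X) = (X+1)\setminus X = 1$, so $\Delta[\mathrm{Id}]$ is the constant functor $1$. Chain rule transformation: for taut $F, G$, the natural transformation $\gamma_{G,F} \colon (\Delta[G]\circ F) \times \Delta[F] \to \Delta[G \circ F]$ is given, for $x \in \Delta[F](A)$ and $y \in \Delta[G](F(A)) \subseteq G(F(A)+1)$, by $\gamma_{G,F}(A)(y,x) = G(\phi_x)(y)$, where $\phi_x = [F(j_A), x] \colon F(A)+1 \to F(A+1)$ is $F(j_A)$ on the first summand and $x$ on the second. $\gamma_{H,G}\circ F$ denotes whiskering: its component at $A$ is $\gamma_{H,G}(F(A))$. *)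

theory Defs
  imports "HOL-Library.FuncSet"
begin

section \<open>The category of sets\<close>

text \<open>
  HOL has no type of all sets, so the category Set is rendered as the category whose objects are the
  small subsets of a type and whose morphisms from X to Y are the extensional functions in
  \<open>X \<rightarrow>\<^sub>E Y\<close> (composition is \<open>compose\<close>). Nothing is required of smallness except that one can form
  inverse images and \<open>X + 1\<close>; so the small sets of any set-theoretic universe are an instance, and so
  are all subsets of any infinite type. The coproduct \<open>X + 1\<close> is \<open>insert pt (inl ` X)\<close>, where
  \<open>inl\<close> and \<open>pt\<close> are arbitrary subject to the disjointness axioms.
\<close>

class set_universe =
  fixes small :: "'a set \<Rightarrow> bool"
    and inl :: "'a \<Rightarrow> 'a"
    and pt :: "'a"
  assumes inj_inl: "inj inl"
    and pt_notin_range_inl: "pt \<notin> range inl"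
    and ex_small: "\<exists>X. small X"
    and small_subset: "small Y \<Longrightarrow> X \<subseteq> Y \<Longrightarrow> small X"
    and small_insert_pt: "small X \<Longrightarrow> small (insert pt (inl ` X))"

instantiation nat :: set_universe
begin
definition small_nat :: "nat set \<Rightarrow> bool" where "small_nat X = True"
definition inl_nat :: "nat \<Rightarrow> nat" where "inl_nat = Suc"
definition pt_nat :: nat where "pt_nat = 0"
instance by standard (auto simp: small_nat_def inl_nat_def pt_nat_def)
end

definition plus1 :: "'u::set_universe set \<Rightarrow> 'u set" where
  "plus1 X = insert pt (inl ` X)"

definition inj1 :: "'u::set_universe set \<Rightarrow> 'u \<Rightarrow> 'u" where
  "inj1 X = (\<lambda>x\<in>X. inl x)"

text \<open>The morphism \<open>[f, z]\<close> on \<open>X + 1\<close>.\<close>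

definition copair1 :: "'u::set_universe set \<Rightarrow> ('u \<Rightarrow> 'v) \<Rightarrow> 'v \<Rightarrow> 'u \<Rightarrow> 'v" where
  "copair1 X f z = (\<lambda>w\<in>plus1 X. if w = pt then z else f (inv inl w))"

text \<open>The morphism \<open>f + 1\<close> from \<open>X + 1\<close> to \<open>Y + 1\<close>.\<close>

definition map_plus1 :: "'u::set_universe set \<Rightarrow> 'u set \<Rightarrow> ('u \<Rightarrow> 'u) \<Rightarrow> 'u \<Rightarrow> 'u" where
  "map_plus1 X Y f = copair1 X (compose X (inj1 Y) f) pt"

definition is_mono :: "'u::set_universe set \<Rightarrow> 'u set \<Rightarrow> ('u \<Rightarrow> 'u) \<Rightarrow> bool" where
  "is_mono A B m \<longleftrightarrow> small A \<and> small B \<and> m \<in> A \<rightarrow>\<^sub>E B \<and>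
     (\<forall>Q :: 'u set. small Q \<longrightarrow> (\<forall>a\<in>Q \<rightarrow>\<^sub>E A. \<forall>b\<in>Q \<rightarrow>\<^sub>E A. compose Q m a = compose Q m b \<longrightarrow> a = b))"

text \<open>
  The square with \<open>p : P \<rightarrow> A\<close>, \<open>q : P \<rightarrow> B\<close>, \<open>f : A \<rightarrow> C\<close>, \<open>g : B \<rightarrow> C\<close> is a pullback square.
\<close>

definition is_pullback ::
  "'u::set_universe set \<Rightarrow> 'u set \<Rightarrow> 'u set \<Rightarrow> 'u set \<Rightarrow>
   ('u \<Rightarrow> 'u) \<Rightarrow> ('u \<Rightarrow> 'u) \<Rightarrow> ('u \<Rightarrow> 'u) \<Rightarrow> ('u \<Rightarrow> 'u) \<Rightarrow> bool" where
  "is_pullback P A B C p q f g \<longleftrightarrow>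
     small P \<and> small A \<and> small B \<and> small C \<and>
     p \<in> P \<rightarrow>\<^sub>E A \<and> q \<in> P \<rightarrow>\<^sub>E B \<and> f \<in> A \<rightarrow>\<^sub>E C \<and> g \<in> B \<rightarrow>\<^sub>E C \<and>
     compose P f p = compose P g q \<and>
     (\<forall>Q :: 'u set. small Q \<longrightarrow> (\<forall>a\<in>Q \<rightarrow>\<^sub>E A. \<forall>b\<in>Q \<rightarrow>\<^sub>E B. compose Q f a = compose Q g b \<longrightarrow>
        (\<exists>!h. h \<in> Q \<rightarrow>\<^sub>E P \<and> compose Q p h = a \<and> compose Q q h = b)))"


section \<open>Functors\<close>

text \<open>
  The target type is allowed to differ from the source type so that products of functors and the
  terminal functor can be formed with the HOL types \<open>\<times>\<close> and \<open>unit\<close>. The arrow part takes the domain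
  and the codomain of the morphism as arguments, since an extensional function does not determine
  its codomain.
\<close>

record ('u, 'v) set_functor =
  Ob :: "'u set \<Rightarrow> 'v set"
  Ar :: "'u set \<Rightarrow> 'u set \<Rightarrow> ('u \<Rightarrow> 'u) \<Rightarrow> 'v \<Rightarrow> 'v"

definition is_functor :: "('u::set_universe, 'v) set_functor \<Rightarrow> bool" where
  "is_functor F \<longleftrightarrow>
     (\<forall>X Y. small X \<longrightarrow> small Y \<longrightarrow> (\<forall>f\<in>X \<rightarrow>\<^sub>E Y. Ar F X Y f \<in> Ob F X \<rightarrow>\<^sub>E Ob F Y)) \<and>
     (\<forall>X. small X \<longrightarrow> Ar F X X (\<lambda>x\<in>X. x) = (\<lambda>x\<in>Ob F X. x)) \<and>
     (\<forall>X Y Z. small X \<longrightarrow> small Y \<longrightarrow> small Z \<longrightarrow> (\<forall>f\<in>X \<rightarrow>\<^sub>E Y. \<forall>g\<in>Y \<rightarrow>\<^sub>E Z.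
        Ar F X Z (compose X g f) = compose (Ob F X) (Ar F Y Z g) (Ar F X Y f)))"

definition is_endofunctor :: "('u::set_universe, 'u) set_functor \<Rightarrow> bool" where
  "is_endofunctor F \<longleftrightarrow> is_functor F \<and> (\<forall>X. small X \<longrightarrow> small (Ob F X))"

definition taut :: "('u::set_universe, 'u) set_functor \<Rightarrow> bool" where
  "taut F \<longleftrightarrow> is_endofunctor F \<and>
     (\<forall>P A B C p q f g. is_pullback P A B C p q f g \<and> is_mono B C g \<longrightarrow>
        is_pullback (Ob F P) (Ob F A) (Ob F B) (Ob F C)
          (Ar F P A p) (Ar F P B q) (Ar F A C f) (Ar F B C g))"

definition id_functor :: "('u, 'u) set_functor" where
  "id_functor = \<lparr>Ob = (\<lambda>X. X), Ar = (\<lambda>X Y f. f)\<rparr>"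

definition one_functor :: "('u, unit) set_functor" where
  "one_functor = \<lparr>Ob = (\<lambda>X. {()}), Ar = (\<lambda>X Y f. \<lambda>u\<in>{()}. u)\<rparr>"

definition comp_functor ::
  "('u, 'v) set_functor \<Rightarrow> ('u, 'u) set_functor \<Rightarrow> ('u, 'v) set_functor" (infixl "\<circ>\<^sub>S" 75) where
  "G \<circ>\<^sub>S F = \<lparr>Ob = (\<lambda>X. Ob G (Ob F X)), Ar = (\<lambda>X Y f. Ar G (Ob F X) (Ob F Y) (Ar F X Y f))\<rparr>"

definition prod_functor ::
  "('u, 'v) set_functor \<Rightarrow> ('u, 'w) set_functor \<Rightarrow> ('u, 'v \<times> 'w) set_functor" (infixr "\<times>\<^sub>S" 70) where
  "M \<times>\<^sub>S N = \<lparr>Ob = (\<lambda>X. Ob M X \<times> Ob N X),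
              Ar = (\<lambda>X Y f. \<lambda>w\<in>Ob M X \<times> Ob N X. map_prod (Ar M X Y f) (Ar N X Y f) w)\<rparr>"

text \<open>The difference functor.\<close>

definition diff_functor :: "('u::set_universe, 'u) set_functor \<Rightarrow> ('u, 'u) set_functor" ("\<Delta>") where
  "\<Delta> F =
     (let D = (\<lambda>X. Ob F (plus1 X) - Ar F X (plus1 X) (inj1 X) ` Ob F X)
      in \<lparr>Ob = D, Ar = (\<lambda>X Y f. \<lambda>w\<in>D X. Ar F (plus1 X) (plus1 Y) (map_plus1 X Y f) w)\<rparr>)"

lemma comp_functor_id [simp]:
  fixes F :: "('u, 'v) set_functor" and G :: "('u, 'u) set_functor"
  shows "F \<circ>\<^sub>S id_functor = F" "id_functor \<circ>\<^sub>S G = G"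
  by (simp_all add: comp_functor_def id_functor_def)

lemma comp_functor_assoc: "(H \<circ>\<^sub>S G) \<circ>\<^sub>S F = H \<circ>\<^sub>S (G \<circ>\<^sub>S F)"
  by (simp add: comp_functor_def)


section \<open>Natural transformations\<close>

record ('u, 'v, 'w) transformation =
  Src :: "('u, 'v) set_functor"
  Tgt :: "('u, 'w) set_functor"
  Cmp :: "'u set \<Rightarrow> 'v \<Rightarrow> 'w"

definition is_nat_trans :: "('u::set_universe, 'v, 'w) transformation \<Rightarrow> bool" where
  "is_nat_trans t \<longleftrightarrow> is_functor (Src t) \<and> is_functor (Tgt t) \<and>
     (\<forall>A. small A \<longrightarrow> Cmp t A \<in> Ob (Src t) A \<rightarrow>\<^sub>E Ob (Tgt t) A) \<and>
     (\<forall>A B. small A \<longrightarrow> small B \<longrightarrow> (\<forall>f\<in>A \<rightarrow>\<^sub>E B.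
        compose (Ob (Src t) A) (Cmp t B) (Ar (Src t) A B f) =
        compose (Ob (Src t) A) (Ar (Tgt t) A B f) (Cmp t A)))"

definition is_nat_iso :: "('u::set_universe, 'v, 'w) transformation \<Rightarrow> bool" where
  "is_nat_iso t \<longleftrightarrow> is_nat_trans t \<and>
     (\<forall>A. small A \<longrightarrow> bij_betw (Cmp t A) (Ob (Src t) A) (Ob (Tgt t) A))"

text \<open>
  Equality of natural transformations; that both sides are natural transformations is part of the
  claim. Plain record equality would also compare the meaningless components at sets that are not
  small.
\<close>

definition eq_trans ::
  "('u::set_universe, 'v, 'w) transformation \<Rightarrow> ('u, 'v, 'w) transformation \<Rightarrow> bool"
  (infix "\<approx>" 50) where
  "s \<approx> t \<longleftrightarrow> is_nat_trans s \<and> is_nat_trans t \<and> Src s = Src t \<and> Tgt s = Tgt t \<and>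
     (\<forall>A. small A \<longrightarrow> Cmp s A = Cmp t A)"

definition id_trans :: "('u, 'v) set_functor \<Rightarrow> ('u, 'v, 'v) transformation" where
  "id_trans M = \<lparr>Src = M, Tgt = M, Cmp = (\<lambda>A. \<lambda>x\<in>Ob M A. x)\<rparr>"

text \<open>Vertical composition; meaningful when \<open>Tgt s = Src t\<close>.\<close>

definition comp_trans ::
  "('u, 'w, 'x) transformation \<Rightarrow> ('u, 'v, 'w) transformation \<Rightarrow> ('u, 'v, 'x) transformation"
  (infixl "\<cdot>" 65) where
  "t \<cdot> s = \<lparr>Src = Src s, Tgt = Tgt t, Cmp = (\<lambda>A. compose (Ob (Src s) A) (Cmp t A) (Cmp s A))\<rparr>"

definition whisker ::
  "('u, 'v, 'w) transformation \<Rightarrow> ('u, 'u) set_functor \<Rightarrow> ('u, 'v, 'w) transformation"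
  (infixl "\<circ>\<^sub>W" 75) where
  "t \<circ>\<^sub>W F = \<lparr>Src = Src t \<circ>\<^sub>S F, Tgt = Tgt t \<circ>\<^sub>S F, Cmp = (\<lambda>A. Cmp t (Ob F A))\<rparr>"

definition prod_trans ::
  "('u, 'v, 'w) transformation \<Rightarrow> ('u, 'x, 'y) transformation \<Rightarrow>
   ('u, 'v \<times> 'x, 'w \<times> 'y) transformation" (infixr "\<times>\<^sub>T" 70) where
  "s \<times>\<^sub>T t = \<lparr>Src = Src s \<times>\<^sub>S Src t, Tgt = Tgt s \<times>\<^sub>S Tgt t,
     Cmp = (\<lambda>A. \<lambda>w\<in>Ob (Src s) A \<times> Ob (Src t) A. map_prod (Cmp s A) (Cmp t A) w)\<rparr>"

text \<open>The canonical isomorphisms for the associativity of the product and for its unit.\<close>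

definition assoc_trans ::
  "('u, 'v) set_functor \<Rightarrow> ('u, 'w) set_functor \<Rightarrow> ('u, 'x) set_functor \<Rightarrow>
   ('u, 'v \<times> 'w \<times> 'x, ('v \<times> 'w) \<times> 'x) transformation" where
  "assoc_trans K M N = \<lparr>Src = K \<times>\<^sub>S (M \<times>\<^sub>S N), Tgt = (K \<times>\<^sub>S M) \<times>\<^sub>S N,
     Cmp = (\<lambda>A. \<lambda>(a, b, c)\<in>Ob K A \<times> Ob M A \<times> Ob N A. ((a, b), c))\<rparr>"

definition left_unit_trans :: "('u, 'v) set_functor \<Rightarrow> ('u, unit \<times> 'v, 'v) transformation" where
  "left_unit_trans M = \<lparr>Src = one_functor \<times>\<^sub>S M, Tgt = M, Cmp = (\<lambda>A. \<lambda>w\<in>{()} \<times> Ob M A. snd w)\<rparr>"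

definition right_unit_trans :: "('u, 'v) set_functor \<Rightarrow> ('u, 'v \<times> unit, 'v) transformation" where
  "right_unit_trans M = \<lparr>Src = M \<times>\<^sub>S one_functor, Tgt = M, Cmp = (\<lambda>A. \<lambda>w\<in>Ob M A \<times> {()}. fst w)\<rparr>"

text \<open>The identification of \<open>\<Delta> id_functor\<close> with the constant functor 1.\<close>

definition diff_id_trans :: "('u::set_universe, 'u, unit) transformation" where
  "diff_id_trans = \<lparr>Src = \<Delta> id_functor, Tgt = one_functor, Cmp = (\<lambda>A. \<lambda>x\<in>Ob (\<Delta> id_functor) A. ())\<rparr>"


section \<open>The chain rule transformation\<close>

definition chain_trans ::
  "('u::set_universe, 'u) set_functor \<Rightarrow> ('u, 'u) set_functor \<Rightarrow> ('u, 'u \<times> 'u, 'u) transformation"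
  ("\<gamma>") where
  "\<gamma> G F = \<lparr>Src = (\<Delta> G \<circ>\<^sub>S F) \<times>\<^sub>S \<Delta> F, Tgt = \<Delta> (G \<circ>\<^sub>S F),
     Cmp = (\<lambda>A. \<lambda>(y, x)\<in>Ob (\<Delta> G) (Ob F A) \<times> Ob (\<Delta> F) A.
        Ar G (plus1 (Ob F A)) (Ob F (plus1 A))
          (copair1 (Ob F A) (Ar F A (plus1 A) (inj1 A)) x) y)\<rparr>"

end

theory Submission
  imports Defs
begin

text \<open>
  For \<open>x \<in> \<Delta> F A\<close> write \<open>\<phi>\<^sub>x = [F j, x]\<close>. Since \<open>x\<close> misses the image of \<open>F j\<close>, the
  square with sides \<open>id\<close>, \<open>j\<close>, \<open>F j\<close> and \<open>\<phi>\<^sub>x\<close> is an inverse image diagram; its preservation by \<open>G\<close>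
  says that \<open>G \<phi>\<^sub>x\<close> maps \<open>\<Delta> G (F A)\<close> into \<open>\<Delta> (G F) A\<close>. Naturality of the chain rule transformation
  reduces to \<open>F (f + 1) \<phi>\<^sub>x = \<phi>\<^sub>x\<^sub>' (F f + 1)\<close> with \<open>x' = \<Delta> F f x\<close>, and associativity to
  \<open>G \<phi>\<^sub>x [G j, y] = [G F j, G \<phi>\<^sub>x y]\<close>.
\<close>

section \<open>The coproduct with a point\<close>

lemma small_plus1: "small X \<Longrightarrow> small (plus1 X)"
  unfolding plus1_def by (rule small_insert_pt)

text \<open>For any small \<open>X\<close>, the point \<open>pt\<close> lies in
  \<open>X + 1\<close>, and subsets of small sets are small. This one-point set is the test object
  by which universal properties become statements about elements.\<close>

lemma small_singleton_pt: "small {pt :: 'u::set_universe}"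
proof -
  obtain X :: "'u set" where "small X" using ex_small by blast
  from small_insert_pt[OF this] show ?thesis by (rule small_subset) simp
qed

lemma inl_neq_pt [simp]: "inl x \<noteq> pt" "pt \<noteq> inl x"
  using pt_notin_range_inl by (metis rangeI)+

lemma inl_eq_iff [simp]: "inl x = inl y \<longleftrightarrow> x = y"
  using inj_inl by (auto dest: injD)

lemma pt_in_plus1 [simp]: "pt \<in> plus1 X"
  by (simp add: plus1_def)

lemma inl_in_plus1 [simp]: "inl x \<in> plus1 X \<longleftrightarrow> x \<in> X"
  by (auto simp: plus1_def)

lemma plus1_cases [consumes 1, case_names pt inl]:
  assumes "w \<in> plus1 X"
  obtains "w = pt" | x where "x \<in> X" "w = inl x"
  using assms by (auto simp: plus1_def)

lemma inj1_apply [simp]: "x \<in> X \<Longrightarrow> inj1 X x = inl x"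
  by (simp add: inj1_def)

lemma inj1_hom: "inj1 X \<in> X \<rightarrow>\<^sub>E plus1 X"
  by (auto simp: inj1_def)

lemma copair1_pt [simp]: "copair1 X f z pt = z"
  by (simp add: copair1_def)

lemma copair1_inl [simp]: "x \<in> X \<Longrightarrow> copair1 X f z (inl x) = f x"
  by (simp add: copair1_def inj_inl)

lemma copair1_hom:
  assumes "f \<in> X \<rightarrow>\<^sub>E Y" "z \<in> Y"
  shows "copair1 X f z \<in> plus1 X \<rightarrow>\<^sub>E Y"
proof (rule PiE_I)
  fix w assume "w \<in> plus1 X"
  then show "copair1 X f z w \<in> Y" using assms by (cases rule: plus1_cases) auto
qed (simp add: copair1_def)

text \<open>Uniqueness half of the universal property of the coproduct. Outside
  \<open>plus1 X\<close> both maps are \<open>undefined\<close>, being extensional; the two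
  codomains may differ because such a function does not determine one.\<close>

lemma plus1_hom_eqI:
  assumes "f \<in> plus1 X \<rightarrow>\<^sub>E Y" "g \<in> plus1 X \<rightarrow>\<^sub>E Z"
    and "f pt = g pt" "\<And>x. x \<in> X \<Longrightarrow> f (inl x) = g (inl x)"
  shows "f = g"
proof
  fix w show "f w = g w"
  proof (cases "w \<in> plus1 X")
    case True
    then show ?thesis using assms(3,4) by (cases rule: plus1_cases) auto
  next
    case False
    then show ?thesis using assms(1,2) by (metis PiE_arb)
  qed
qed

lemma map_plus1_pt [simp]: "map_plus1 X Y f pt = pt"
  by (simp add: map_plus1_def)

lemma map_plus1_inl [simp]: "x \<in> X \<Longrightarrow> f x \<in> Y \<Longrightarrow> map_plus1 X Y f (inl x) = inl (f x)"
  by (simp add: map_plus1_def compose_def)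

lemma compose_hom: "f \<in> X \<rightarrow>\<^sub>E Y \<Longrightarrow> g \<in> Y \<rightarrow>\<^sub>E Z \<Longrightarrow> compose X g f \<in> X \<rightarrow>\<^sub>E Z"
  by (auto simp: compose_def)

lemma id_hom: "(\<lambda>x\<in>X. x) \<in> X \<rightarrow>\<^sub>E X"
  by auto

lemma map_plus1_hom: "f \<in> X \<rightarrow>\<^sub>E Y \<Longrightarrow> map_plus1 X Y f \<in> plus1 X \<rightarrow>\<^sub>E plus1 Y"
  unfolding map_plus1_def by (intro copair1_hom compose_hom[OF _ inj1_hom]) auto

lemma map_plus1_id: "map_plus1 X X (\<lambda>x\<in>X. x) = (\<lambda>w\<in>plus1 X. w)"
  by (rule plus1_hom_eqI[OF map_plus1_hom[OF id_hom] id_hom]) auto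

lemma map_plus1_compose:
  assumes "f \<in> X \<rightarrow>\<^sub>E Y" "g \<in> Y \<rightarrow>\<^sub>E Z"
  shows "map_plus1 X Z (compose X g f) = compose (plus1 X) (map_plus1 Y Z g) (map_plus1 X Y f)"
proof (rule plus1_hom_eqI)
  show "map_plus1 X Z (compose X g f) \<in> plus1 X \<rightarrow>\<^sub>E plus1 Z"
    using assms by (intro map_plus1_hom compose_hom)
  show "compose (plus1 X) (map_plus1 Y Z g) (map_plus1 X Y f) \<in> plus1 X \<rightarrow>\<^sub>E plus1 Z"
    using assms by (intro compose_hom[OF map_plus1_hom map_plus1_hom])
next
  fix x assume x: "x \<in> X"
  with assms have "f x \<in> Y" "g (f x) \<in> Z" by auto
  with x show "map_plus1 X Z (compose X g f) (inl x)
      = compose (plus1 X) (map_plus1 Y Z g) (map_plus1 X Y f) (inl x)"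
    by (simp add: compose_eq)
qed (simp add: compose_eq)

text \<open>Naturality of the injection j. It makes the square of
  \<open>is_pullback_map_plus1\<close> commute and later moves F(f + 1) past F(j).\<close>

lemma map_plus1_inj1:
  assumes "f \<in> X \<rightarrow>\<^sub>E Y"
  shows "compose X (map_plus1 X Y f) (inj1 X) = compose X (inj1 Y) f"
proof
  fix x show "compose X (map_plus1 X Y f) (inj1 X) x = compose X (inj1 Y) f x"
  proof (cases "x \<in> X")
    case True
    with assms have "f x \<in> Y" by auto
    with True show ?thesis by (simp add: compose_eq)
  qed (simp add: compose_def)
qed

lemma copair1_inj1:
  assumes "f \<in> X \<rightarrow>\<^sub>E Y"
  shows "compose X (copair1 X f z) (inj1 X) = f"
proof
  fix x show "compose X (copair1 X f z) (inj1 X) x = f x"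
    using assms by (cases "x \<in> X") (auto simp: compose_def)
qed

text \<open>Used from left to right to move F(f + 1) into a copairing for naturality, and from right
  to left to factor a map out of one for associativity.\<close>

lemma compose_copair1:
  assumes "f \<in> X \<rightarrow>\<^sub>E Y" "z \<in> Y" "g \<in> Y \<rightarrow>\<^sub>E Z"
  shows "compose (plus1 X) g (copair1 X f z) = copair1 X (compose X g f) (g z)"
proof (rule plus1_hom_eqI)
  show "compose (plus1 X) g (copair1 X f z) \<in> plus1 X \<rightarrow>\<^sub>E Z"
    using assms by (intro compose_hom copair1_hom)
  show "copair1 X (compose X g f) (g z) \<in> plus1 X \<rightarrow>\<^sub>E Z"
    using assms by (intro compose_hom copair1_hom) auto
qed (simp_all add: compose_eq)

text \<open>The companion law for precomposition, needed for the side of the naturality identity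
  that starts with F f + 1.\<close>

lemma copair1_map_plus1:
  assumes "f \<in> X \<rightarrow>\<^sub>E Y" "g \<in> Y \<rightarrow>\<^sub>E Z" "z \<in> Z"
  shows "compose (plus1 X) (copair1 Y g z) (map_plus1 X Y f) = copair1 X (compose X g f) z"
proof (rule plus1_hom_eqI)
  show "compose (plus1 X) (copair1 Y g z) (map_plus1 X Y f) \<in> plus1 X \<rightarrow>\<^sub>E Z"
    using assms by (intro compose_hom[OF map_plus1_hom copair1_hom])
  show "copair1 X (compose X g f) z \<in> plus1 X \<rightarrow>\<^sub>E Z"
    using assms by (intro compose_hom copair1_hom)
next
  fix x assume x: "x \<in> X"
  with assms have "f x \<in> Y" by auto
  with x show "compose (plus1 X) (copair1 Y g z) (map_plus1 X Y f) (inl x)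
      = copair1 X (compose X g f) z (inl x)"
    by (simp add: compose_eq)
qed (simp add: compose_eq)


section \<open>Inverse image diagrams\<close>

lemma is_monoI:
  assumes "small A" "small B" "m \<in> A \<rightarrow>\<^sub>E B" "inj_on m A"
  shows "is_mono A B m"
  unfolding is_mono_def
proof (intro conjI allI impI ballI)
  fix Q a b assume ab: "a \<in> Q \<rightarrow>\<^sub>E A" "b \<in> Q \<rightarrow>\<^sub>E A" and eq: "compose Q m a = compose Q m b"
  show "a = b"
  proof (rule PiE_ext[OF ab])
    fix x assume x: "x \<in> Q"
    then have "m (a x) = m (b x)" using fun_cong[OF eq, of x] by (simp add: compose_eq)
    with x ab show "a x = b x" by (auto dest: inj_onD[OF assms(4)])
  qed
qed (use assms in auto)

text \<open>Injectivity of \<open>p\<close> alone gives uniqueness of the mediating map. This suits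
  pullbacks of monomorphisms, where \<open>p\<close> is itself mono; in the squares below it is an
  identity or j.\<close>

lemma is_pullbackI:
  assumes "small P" "small A" "small B" "small C"
    and p: "p \<in> P \<rightarrow>\<^sub>E A" and q: "q \<in> P \<rightarrow>\<^sub>E B" and "f \<in> A \<rightarrow>\<^sub>E C" "g \<in> B \<rightarrow>\<^sub>E C"
    and comm: "compose P f p = compose P g q"
    and inj: "inj_on p P"
    and lift: "\<And>a b. a \<in> A \<Longrightarrow> b \<in> B \<Longrightarrow> f a = g b \<Longrightarrow> \<exists>c\<in>P. p c = a \<and> q c = b"
  shows "is_pullback P A B C p q f g"
  unfolding is_pullback_def
proof (intro conjI allI impI ballI)
  fix Q a b assume a: "a \<in> Q \<rightarrow>\<^sub>E A" and b: "b \<in> Q \<rightarrow>\<^sub>E B"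
    and eq: "compose Q f a = compose Q g b"
  have "\<exists>c\<in>P. p c = a x \<and> q c = b x" if x: "x \<in> Q" for x
  proof (rule lift)
    show "a x \<in> A" "b x \<in> B" using a b x by auto
    show "f (a x) = g (b x)" using fun_cong[OF eq, of x] x by (simp add: compose_eq)
  qed
  then have "\<forall>x\<in>Q. \<exists>c. c \<in> P \<and> p c = a x \<and> q c = b x" by blast
  \<comment> \<open>The mediating map is chosen pointwise from \<open>lift\<close>; restricting it
    to \<open>Q\<close> makes it extensional.\<close>
  from bchoice[OF this] obtain c where c: "\<forall>x\<in>Q. c x \<in> P \<and> p (c x) = a x \<and> q (c x) = b x" ..
  have hom: "restrict c Q \<in> Q \<rightarrow>\<^sub>E P" using c by auto
  show "\<exists>!h. h \<in> Q \<rightarrow>\<^sub>E P \<and> compose Q p h = a \<and> compose Q q h = b"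
  proof (intro ex1I conjI; (elim conjE)?)
    show "restrict c Q \<in> Q \<rightarrow>\<^sub>E P" by (rule hom)
    show "compose Q p (restrict c Q) = a"
      by (rule PiE_ext[OF compose_hom[OF hom p] a]) (simp add: compose_eq c)
    show "compose Q q (restrict c Q) = b"
      by (rule PiE_ext[OF compose_hom[OF hom q] b]) (simp add: compose_eq c)
    fix h assume h: "h \<in> Q \<rightarrow>\<^sub>E P" and ph: "compose Q p h = a"
    show "h = restrict c Q"
    proof (rule PiE_ext[OF h hom])
      fix x assume x: "x \<in> Q"
      have "p (h x) = p (c x)" using fun_cong[OF ph, of x] x c by (simp add: compose_eq)
      moreover have "h x \<in> P" "c x \<in> P" using h x c by auto
      ultimately show "h x = restrict c Q x" using x by (simp add: inj_onD[OF inj])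
    qed
  qed
qed (simp_all add: assms(1-9))

text \<open>The point \<open>{pt}\<close> is the only test object that is needed.\<close>

lemma is_pullback_lift:
  assumes pb: "is_pullback P A B C p q f g" and ab: "a \<in> A" "b \<in> B" "f a = g b"
  shows "\<exists>c\<in>P. p c = a \<and> q c = b"
proof -
  let ?Q = "{pt :: 'a}"
  have "(\<lambda>u\<in>?Q. a) \<in> ?Q \<rightarrow>\<^sub>E A" "(\<lambda>u\<in>?Q. b) \<in> ?Q \<rightarrow>\<^sub>E B"
    and "compose ?Q f (\<lambda>u\<in>?Q. a) = compose ?Q g (\<lambda>u\<in>?Q. b)"
    using ab by (auto simp: compose_def)
  then have "\<exists>!h. h \<in> ?Q \<rightarrow>\<^sub>E P \<and> compose ?Q p h = (\<lambda>u\<in>?Q. a) \<and> compose ?Q q h = (\<lambda>u\<in>?Q. b)"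
    using pb small_singleton_pt unfolding is_pullback_def by blast
  then obtain h where h: "h \<in> ?Q \<rightarrow>\<^sub>E P" "compose ?Q p h = (\<lambda>u\<in>?Q. a)"
      "compose ?Q q h = (\<lambda>u\<in>?Q. b)"
    by blast
  have "p (h pt) = a" "q (h pt) = b"
    using fun_cong[OF h(2), of pt] fun_cong[OF h(3), of pt] by (simp_all add: compose_eq)
  moreover have "h pt \<in> P" using h(1) by auto
  ultimately show ?thesis by blast
qed

text \<open>Elements of \<open>A\<close> are maps from the point, so cancelling \<open>m\<close>
  against two of them gives injectivity.\<close>

lemma is_mono_inj_on:
  assumes m: "is_mono A B m"
  shows "inj_on m A"
proof (rule inj_onI)
  fix a b assume ab: "a \<in> A" "b \<in> A" "m a = m b"
  let ?Q = "{pt :: 'a}"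
  have "(\<lambda>u\<in>?Q. a) \<in> ?Q \<rightarrow>\<^sub>E A" "(\<lambda>u\<in>?Q. b) \<in> ?Q \<rightarrow>\<^sub>E A"
    and "compose ?Q m (\<lambda>u\<in>?Q. a) = compose ?Q m (\<lambda>u\<in>?Q. b)"
    using ab by (auto simp: compose_def)
  then have eq: "(\<lambda>u\<in>?Q. a) = (\<lambda>u\<in>?Q. b)"
    using m small_singleton_pt unfolding is_mono_def by blast
  show "a = b" using fun_cong[OF eq, of pt] by simp
qed

section \<open>The inverse image diagrams to which tautness is applied\<close>

lemma is_mono_inj1: "small X \<Longrightarrow> is_mono X (plus1 X) (inj1 X)"
  by (intro is_monoI small_plus1 inj1_hom) (auto simp: inj_on_def)

text \<open>A pair identified by the injective \<open>m\<close> is diagonal, so the kernel pair has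
  identity legs. This presents being mono as an inverse image diagram, which tautness can then carry
  over.\<close>

lemma is_pullback_mono_kernel:
  assumes "is_mono A B m"
  shows "is_pullback A A A B (\<lambda>x\<in>A. x) (\<lambda>x\<in>A. x) m m"
proof (rule is_pullbackI)
  show "inj_on (\<lambda>x\<in>A. x) A" by (auto simp: inj_on_def)
  show "\<exists>c\<in>A. (\<lambda>x\<in>A. x) c = a \<and> (\<lambda>x\<in>A. x) c = b" if "a \<in> A" "b \<in> A" "m a = m b" for a b
    using that is_mono_inj_on[OF assms] by (auto dest: inj_onD)
qed (use assms in \<open>auto simp: is_mono_def\<close>)

text \<open>The map f + 1 sends \<open>pt\<close> to \<open>pt\<close>, which is no value of j, so
  whatever lands in the image of j comes from \<open>X\<close>. Preserved by F, this square makes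
  F(f + 1) restrict to the difference functors.\<close>

lemma is_pullback_map_plus1:
  assumes "small X" "small Y" and f: "f \<in> X \<rightarrow>\<^sub>E Y"
  shows "is_pullback X (plus1 X) Y (plus1 Y) (inj1 X) f (map_plus1 X Y f) (inj1 Y)"
proof (rule is_pullbackI)
  show "compose X (map_plus1 X Y f) (inj1 X) = compose X (inj1 Y) f"
    by (rule map_plus1_inj1[OF f])
  show "inj_on (inj1 X) X" by (auto simp: inj_on_def)
  show "\<exists>c\<in>X. inj1 X c = w \<and> f c = y"
    if "w \<in> plus1 X" "y \<in> Y" "map_plus1 X Y f w = inj1 Y y" for w y
    using that(1)
  proof (cases rule: plus1_cases)
    case (inl x)
    with f have "f x \<in> Y" by auto
    with inl that show ?thesis by (intro bexI[of _ x]) auto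
  qed (use that in auto)
qed (use assms in \<open>simp_all add: small_plus1 inj1_hom map_plus1_hom\<close>)

text \<open>The point goes to \<open>z\<close>, outside the image of \<open>m\<close>, so only the
  summand \<open>X\<close> meets that image, and there injectivity of \<open>m\<close> identifies
  the two elements. It is applied with \<open>m\<close> = F(j) and \<open>z\<close> = x.\<close>

lemma is_pullback_copair1:
  assumes "small X" "small Y" and m: "is_mono X Y m" and z: "z \<in> Y - m ` X"
  shows "is_pullback X (plus1 X) X Y (inj1 X) (\<lambda>x\<in>X. x) (copair1 X m z) m"
proof (rule is_pullbackI)
  have hom: "m \<in> X \<rightarrow>\<^sub>E Y" using m by (simp add: is_mono_def)
  then show "m \<in> X \<rightarrow>\<^sub>E Y" .
  show "copair1 X m z \<in> plus1 X \<rightarrow>\<^sub>E Y" using hom z by (intro copair1_hom) auto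
  have "compose X m (\<lambda>x\<in>X. x) = m"
    by (rule PiE_ext[OF compose_hom[OF id_hom hom] hom]) (simp add: compose_eq)
  then show "compose X (copair1 X m z) (inj1 X) = compose X m (\<lambda>x\<in>X. x)"
    by (simp only: copair1_inj1[OF hom])
  show "inj_on (inj1 X) X" by (auto simp: inj_on_def)
  show "\<exists>c\<in>X. inj1 X c = w \<and> (\<lambda>x\<in>X. x) c = y"
    if "w \<in> plus1 X" "y \<in> X" "copair1 X m z w = m y" for w y
    using that(1)
  proof (cases rule: plus1_cases)
    case (inl x)
    with that is_mono_inj_on[OF m] have "x = y" by (auto dest: inj_onD)
    with inl show ?thesis by auto
  qed (use that z in auto)
qed (use assms in \<open>simp_all add: small_plus1 inj1_hom id_hom del: restrict_PiE_iff\<close>)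


section \<open>Functors\<close>

lemma functor_hom:
  "is_functor F \<Longrightarrow> small X \<Longrightarrow> small Y \<Longrightarrow> f \<in> X \<rightarrow>\<^sub>E Y \<Longrightarrow> Ar F X Y f \<in> Ob F X \<rightarrow>\<^sub>E Ob F Y"
  by (simp add: is_functor_def)

lemma functor_id: "is_functor F \<Longrightarrow> small X \<Longrightarrow> Ar F X X (\<lambda>x\<in>X. x) = (\<lambda>x\<in>Ob F X. x)"
  by (simp add: is_functor_def)

lemma functor_compose:
  "is_functor F \<Longrightarrow> small X \<Longrightarrow> small Y \<Longrightarrow> small Z \<Longrightarrow> f \<in> X \<rightarrow>\<^sub>E Y \<Longrightarrow> g \<in> Y \<rightarrow>\<^sub>E Z \<Longrightarrow>
    Ar F X Z (compose X g f) = compose (Ob F X) (Ar F Y Z g) (Ar F X Y f)"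
  unfolding is_functor_def by blast

lemma functor_compose_apply:
  assumes "is_functor F" "small X" "small Y" "small Z" "f \<in> X \<rightarrow>\<^sub>E Y" "g \<in> Y \<rightarrow>\<^sub>E Z" "a \<in> Ob F X"
  shows "Ar F Y Z g (Ar F X Y f a) = Ar F X Z (compose X g f) a"
  using assms by (simp add: functor_compose compose_eq)

lemma functor_apply_mem:
  "is_functor F \<Longrightarrow> small X \<Longrightarrow> small Y \<Longrightarrow> f \<in> X \<rightarrow>\<^sub>E Y \<Longrightarrow> a \<in> Ob F X \<Longrightarrow> Ar F X Y f a \<in> Ob F Y"
  using functor_hom by (metis PiE_mem)

text \<open>The first premise makes both sides of each functor law extensional on
  \<open>Ob F X\<close>, so agreement on elements suffices.\<close>

lemma is_functorI:
  assumes "\<And>X Y f. small X \<Longrightarrow> small Y \<Longrightarrow> f \<in> X \<rightarrow>\<^sub>E Y \<Longrightarrow> Ar F X Y f \<in> Ob F X \<rightarrow>\<^sub>E Ob F Y"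
    and "\<And>X a. small X \<Longrightarrow> a \<in> Ob F X \<Longrightarrow> Ar F X X (\<lambda>x\<in>X. x) a = a"
    and "\<And>X Y Z f g a. small X \<Longrightarrow> small Y \<Longrightarrow> small Z \<Longrightarrow> f \<in> X \<rightarrow>\<^sub>E Y \<Longrightarrow> g \<in> Y \<rightarrow>\<^sub>E Z \<Longrightarrow> a \<in> Ob F X \<Longrightarrow>
      Ar F X Z (compose X g f) a = Ar F Y Z g (Ar F X Y f a)"
  shows "is_functor F"
  unfolding is_functor_def
proof (intro conjI allI impI ballI)
  fix X :: "'a set" assume X: "small X"
  show "Ar F X X (\<lambda>x\<in>X. x) = (\<lambda>x\<in>Ob F X. x)"
    by (rule PiE_ext[OF assms(1)[OF X X id_hom] id_hom]) (simp add: assms(2) X)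
next
  fix X Y Z :: "'a set" and f g
  assume *: "small X" "small Y" "small Z" "f \<in> X \<rightarrow>\<^sub>E Y" "g \<in> Y \<rightarrow>\<^sub>E Z"
  show "Ar F X Z (compose X g f) = compose (Ob F X) (Ar F Y Z g) (Ar F X Y f)"
    by (rule PiE_ext[OF assms(1)[OF *(1,3) compose_hom[OF *(4,5)]]
          compose_hom[OF assms(1)[OF *(1,2,4)] assms(1)[OF *(2,3,5)]]])
      (simp add: assms(3)[OF *] compose_eq)
qed (rule assms(1))

lemma Ob_comp_functor [simp]: "Ob (G \<circ>\<^sub>S F) X = Ob G (Ob F X)"
  and Ar_comp_functor [simp]: "Ar (G \<circ>\<^sub>S F) X Y f = Ar G (Ob F X) (Ob F Y) (Ar F X Y f)"
  by (simp_all add: comp_functor_def)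

lemma Ob_prod_functor [simp]: "Ob (M \<times>\<^sub>S N) X = Ob M X \<times> Ob N X"
  and Ar_prod_functor [simp]: "Ar (M \<times>\<^sub>S N) X Y f
    = (\<lambda>w\<in>Ob M X \<times> Ob N X. map_prod (Ar M X Y f) (Ar N X Y f) w)"
  by (simp_all add: prod_functor_def)

lemma Ob_one_functor [simp]: "Ob one_functor X = {()}"
  and Ar_one_functor [simp]: "Ar one_functor X Y f = (\<lambda>u\<in>{()}. u)"
  by (simp_all add: one_functor_def)

lemma Ob_id_functor [simp]: "Ob id_functor X = X"
  and Ar_id_functor [simp]: "Ar id_functor X Y f = f"
  by (simp_all add: id_functor_def)

lemma Ob_diff_functor: "Ob (\<Delta> F) X = Ob F (plus1 X) - Ar F X (plus1 X) (inj1 X) ` Ob F X"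
  and Ar_diff_functor: "Ar (\<Delta> F) X Y f
    = (\<lambda>w\<in>Ob (\<Delta> F) X. Ar F (plus1 X) (plus1 Y) (map_plus1 X Y f) w)"
  by (simp_all add: diff_functor_def Let_def)

lemma is_functor_one: "is_functor (one_functor :: ('u::set_universe, unit) set_functor)"
  by (rule is_functorI) auto

lemma is_functor_id: "is_functor (id_functor :: ('u::set_universe, 'u) set_functor)"
  by (rule is_functorI) (auto simp: compose_eq)

lemma is_functor_prod:
  assumes M: "is_functor M" and N: "is_functor N"
  shows "is_functor (M \<times>\<^sub>S N)"
  by (rule is_functorI)
    (use M N in \<open>auto simp: functor_id functor_compose_apply functor_apply_mem\<close>)

lemma is_functor_comp:
  assumes G: "is_functor G" and "is_endofunctor F"
  shows "is_functor (G \<circ>\<^sub>S F)"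
proof -
  have F: "is_functor F" and sm: "\<And>X. small X \<Longrightarrow> small (Ob F X)"
    using assms(2) by (auto simp: is_endofunctor_def)
  show ?thesis
    by (rule is_functorI)
      (simp_all add: functor_hom functor_id functor_compose functor_compose_apply sm F G compose_eq)
qed

lemma is_endofunctor_comp:
  "is_endofunctor G \<Longrightarrow> is_endofunctor F \<Longrightarrow> is_endofunctor (G \<circ>\<^sub>S F)"
  using is_functor_comp[of G F] by (auto simp: is_endofunctor_def)


section \<open>Taut functors\<close>

lemma taut_endofunctor: "taut F \<Longrightarrow> is_endofunctor F"
  by (simp add: taut_def)

lemma taut_functor: "taut F \<Longrightarrow> is_functor F"
  by (simp add: taut_def is_endofunctor_def)

lemma taut_small: "taut F \<Longrightarrow> small X \<Longrightarrow> small (Ob F X)"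
  by (simp add: taut_def is_endofunctor_def)

lemma taut_pullback:
  "taut F \<Longrightarrow> is_pullback P A B C p q f g \<Longrightarrow> is_mono B C g \<Longrightarrow>
    is_pullback (Ob F P) (Ob F A) (Ob F B) (Ob F C)
      (Ar F P A p) (Ar F P B q) (Ar F A C f) (Ar F B C g)"
  unfolding taut_def by blast

text \<open>The preserved kernel pair square of \<open>m\<close> again has identity legs, and its
  lifting property is injectivity of F(m).\<close>

lemma taut_mono:
  assumes F: "taut F" and m: "is_mono A B m"
  shows "is_mono (Ob F A) (Ob F B) (Ar F A B m)"
proof (rule is_monoI)
  have *: "small A" "small B" "m \<in> A \<rightarrow>\<^sub>E B" using m by (auto simp: is_mono_def)
  then show "small (Ob F A)" "small (Ob F B)" "Ar F A B m \<in> Ob F A \<rightarrow>\<^sub>E Ob F B"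
    using F by (simp_all add: taut_small functor_hom taut_functor)
  note pb = taut_pullback[OF F is_pullback_mono_kernel[OF m] m]
  show "inj_on (Ar F A B m) (Ob F A)"
  proof (rule inj_onI)
    fix a b assume "a \<in> Ob F A" "b \<in> Ob F A" "Ar F A B m a = Ar F A B m b"
    \<comment> \<open>The lifted element is sent by F(id) both to \<open>a\<close> and to
      \<open>b\<close>, and F(id) is the identity.\<close>
    from is_pullback_lift[OF pb this] show "a = b"
      using * by (auto simp: functor_id[OF taut_functor[OF F]])
  qed
qed

lemma taut_id: "taut (id_functor :: ('u::set_universe, 'u) set_functor)"
  by (auto simp: taut_def is_endofunctor_def is_functor_id)

text \<open>Tautness of \<open>G\<close> applies to the image of a square under \<open>F\<close>
  only if F(g) is again mono, which is \<open>taut_mono\<close>.\<close>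

lemma taut_comp:
  assumes G: "taut G" and F: "taut F"
  shows "taut (G \<circ>\<^sub>S F)"
  unfolding taut_def
  using is_endofunctor_comp[OF assms[THEN taut_endofunctor]]
  by (auto intro!: taut_pullback[OF G] taut_pullback[OF F] taut_mono[OF F])

section \<open>The difference functor of a taut functor\<close>

lemma taut_Ar_inj1_hom:
  "taut F \<Longrightarrow> small X \<Longrightarrow> Ar F X (plus1 X) (inj1 X) \<in> Ob F X \<rightarrow>\<^sub>E Ob F (plus1 X)"
  by (intro functor_hom taut_functor small_plus1 inj1_hom)

text \<open>If the image of \<open>w\<close> were F(j)(b), the preserved square of
  \<open>is_pullback_map_plus1\<close> would yield a preimage of \<open>w\<close> under F(j),
  contrary to the choice of \<open>w\<close>.\<close>

lemma diff_functor_mem: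
  assumes F: "taut F" and sm: "small X" "small Y" and f: "f \<in> X \<rightarrow>\<^sub>E Y" and w: "w \<in> Ob (\<Delta> F) X"
  shows "Ar F (plus1 X) (plus1 Y) (map_plus1 X Y f) w \<in> Ob (\<Delta> F) Y"
proof -
  have w': "w \<in> Ob F (plus1 X)" using w by (simp add: Ob_diff_functor)
  have "Ar F (plus1 X) (plus1 Y) (map_plus1 X Y f) w \<noteq> Ar F Y (plus1 Y) (inj1 Y) b"
    if "b \<in> Ob F Y" for b
  proof
    assume "Ar F (plus1 X) (plus1 Y) (map_plus1 X Y f) w = Ar F Y (plus1 Y) (inj1 Y) b"
    from is_pullback_lift[OF taut_pullback[OF F is_pullback_map_plus1[OF sm f]
        is_mono_inj1[OF sm(2)]] w' that this]
    show False using w by (auto simp: Ob_diff_functor)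
  qed
  moreover have "Ar F (plus1 X) (plus1 Y) (map_plus1 X Y f) w \<in> Ob F (plus1 Y)"
    using sm f w' by (intro functor_apply_mem taut_functor F small_plus1 map_plus1_hom)
  ultimately show ?thesis by (auto simp: Ob_diff_functor)
qed

lemma is_functor_diff:
  assumes F: "taut F"
  shows "is_functor (\<Delta> F)"
proof (rule is_functorI)
  fix X Y :: "'a set" and f assume "small X" "small Y" "f \<in> X \<rightarrow>\<^sub>E Y"
  then show "Ar (\<Delta> F) X Y f \<in> Ob (\<Delta> F) X \<rightarrow>\<^sub>E Ob (\<Delta> F) Y"
    by (auto simp: Ar_diff_functor intro: diff_functor_mem[OF F])
next
  fix X :: "'a set" and a assume "small X" "a \<in> Ob (\<Delta> F) X"
  then show "Ar (\<Delta> F) X X (\<lambda>x\<in>X. x) a = a"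
    \<comment> \<open>Membership of \<open>a\<close> stays folded to evaluate the restricted arrow;
      unfolded afterwards, it places \<open>a\<close> in F(X + 1), on which F(id) is the
      identity.\<close>
    by (simp add: Ar_diff_functor map_plus1_id functor_id taut_functor F small_plus1)
      (simp add: Ob_diff_functor)
next
  fix X Y Z :: "'a set" and f g a
  assume *: "small X" "small Y" "small Z" "f \<in> X \<rightarrow>\<^sub>E Y" "g \<in> Y \<rightarrow>\<^sub>E Z" "a \<in> Ob (\<Delta> F) X"
  then have "a \<in> Ob F (plus1 X)" by (simp add: Ob_diff_functor)
  with * show "Ar (\<Delta> F) X Z (compose X g f) a = Ar (\<Delta> F) Y Z g (Ar (\<Delta> F) X Y f a)"
    by (simp add: Ar_diff_functor diff_functor_mem[OF F] map_plus1_compose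
        functor_compose_apply taut_functor F small_plus1 map_plus1_hom)
qed

text \<open>This is \<Delta>[Id] = 1 in concrete form. As a simplification rule it forces the
  \<Delta>[Id] coordinate to be \<open>pt\<close> in the unit laws.\<close>

lemma diff_id_Ob [simp]: "Ob (\<Delta> id_functor) X = {pt}"
proof -
  have "inj1 X ` X = inl ` X" by simp
  then show ?thesis by (auto simp: Ob_diff_functor plus1_def)
qed


section \<open>Natural transformations\<close>

lemma is_nat_transI:
  assumes "is_functor (Src t)" "is_functor (Tgt t)"
    and "\<And>A. small A \<Longrightarrow> Cmp t A \<in> Ob (Src t) A \<rightarrow>\<^sub>E Ob (Tgt t) A"
    and "\<And>A B f a. small A \<Longrightarrow> small B \<Longrightarrow> f \<in> A \<rightarrow>\<^sub>E B \<Longrightarrow> a \<in> Ob (Src t) A \<Longrightarrow>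
      Cmp t B (Ar (Src t) A B f a) = Ar (Tgt t) A B f (Cmp t A a)"
  shows "is_nat_trans t"
  using assms by (auto simp: is_nat_trans_def compose_def intro!: restrict_ext)

lemma nat_trans_Src: "is_nat_trans t \<Longrightarrow> is_functor (Src t)"
  and nat_trans_Tgt: "is_nat_trans t \<Longrightarrow> is_functor (Tgt t)"
  and nat_trans_hom: "is_nat_trans t \<Longrightarrow> small A \<Longrightarrow> Cmp t A \<in> Ob (Src t) A \<rightarrow>\<^sub>E Ob (Tgt t) A"
  by (simp_all add: is_nat_trans_def)

lemma nat_trans_mem: "is_nat_trans t \<Longrightarrow> small A \<Longrightarrow> a \<in> Ob (Src t) A \<Longrightarrow> Cmp t A a \<in> Ob (Tgt t) A"
  using nat_trans_hom by (metis PiE_mem)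

lemma nat_trans_natural:
  assumes "is_nat_trans t" "small A" "small B" "f \<in> A \<rightarrow>\<^sub>E B" "a \<in> Ob (Src t) A"
  shows "Cmp t B (Ar (Src t) A B f a) = Ar (Tgt t) A B f (Cmp t A a)"
proof -
  have "compose (Ob (Src t) A) (Cmp t B) (Ar (Src t) A B f) a
      = compose (Ob (Src t) A) (Ar (Tgt t) A B f) (Cmp t A) a"
    using assms by (simp add: is_nat_trans_def)
  with assms(5) show ?thesis by (simp add: compose_eq)
qed

lemma is_nat_trans_id: "is_functor M \<Longrightarrow> is_nat_trans (id_trans M)"
  by (rule is_nat_transI) (auto simp: id_trans_def functor_apply_mem)

lemma is_nat_trans_comp:
  assumes s: "is_nat_trans s" and t: "is_nat_trans t" and "Tgt s = Src t"
  shows "is_nat_trans (t \<cdot> s)"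
proof (rule is_nat_transI)
  show "is_functor (Src (t \<cdot> s))" "is_functor (Tgt (t \<cdot> s))"
    using s t by (simp_all add: comp_trans_def nat_trans_Src nat_trans_Tgt)
  show "Cmp (t \<cdot> s) A \<in> Ob (Src (t \<cdot> s)) A \<rightarrow>\<^sub>E Ob (Tgt (t \<cdot> s)) A" if "small A" for A
    using nat_trans_hom[OF s that] nat_trans_hom[OF t that] assms(3)
    by (simp add: comp_trans_def compose_hom)
  show "Cmp (t \<cdot> s) B (Ar (Src (t \<cdot> s)) A B f a) = Ar (Tgt (t \<cdot> s)) A B f (Cmp (t \<cdot> s) A a)"
    if "small A" "small B" "f \<in> A \<rightarrow>\<^sub>E B" "a \<in> Ob (Src (t \<cdot> s)) A" for A B f a
    using that assms(3) nat_trans_mem[OF s, of A a]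
    by (simp add: comp_trans_def compose_eq functor_apply_mem nat_trans_Src s
        nat_trans_natural[OF s] nat_trans_natural[OF t])
qed

lemma is_nat_trans_prod:
  assumes s: "is_nat_trans s" and t: "is_nat_trans t"
  shows "is_nat_trans (s \<times>\<^sub>T t)"
  by (rule is_nat_transI)
    (use s t in \<open>auto simp: prod_trans_def is_functor_prod nat_trans_Src nat_trans_Tgt nat_trans_mem
      functor_apply_mem nat_trans_natural\<close>)

lemma is_nat_trans_whisker:
  assumes t: "is_nat_trans t" and F: "is_endofunctor F"
  shows "is_nat_trans (t \<circ>\<^sub>W F)"
proof -
  have "is_functor F" and "\<And>X. small X \<Longrightarrow> small (Ob F X)"
    using F by (auto simp: is_endofunctor_def)
  then show ?thesis
    by (intro is_nat_transI)
      (use t F in \<open>simp_all add: whisker_def is_functor_comp nat_trans_Src nat_trans_Tgt nat_trans_hom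
        functor_hom nat_trans_natural\<close>)
qed

lemma is_nat_trans_assoc:
  assumes "is_functor K" "is_functor M" "is_functor N"
  shows "is_nat_trans (assoc_trans K M N)"
  by (rule is_nat_transI)
    (use assms in \<open>auto simp: assoc_trans_def is_functor_prod functor_apply_mem\<close>)

lemma is_nat_trans_left_unit: "is_functor M \<Longrightarrow> is_nat_trans (left_unit_trans M)"
  by (rule is_nat_transI)
    (auto simp: left_unit_trans_def is_functor_prod is_functor_one functor_apply_mem)

lemma is_nat_trans_right_unit: "is_functor M \<Longrightarrow> is_nat_trans (right_unit_trans M)"
  by (rule is_nat_transI)
    (auto simp: right_unit_trans_def is_functor_prod is_functor_one functor_apply_mem)

lemma is_nat_trans_diff_id: "is_nat_trans diff_id_trans"
  by (rule is_nat_transI)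
    (auto simp: diff_id_trans_def is_functor_diff taut_id is_functor_one Ar_diff_functor)

lemma is_nat_iso_diff_id: "is_nat_iso diff_id_trans"
  using is_nat_trans_diff_id by (auto simp: is_nat_iso_def diff_id_trans_def bij_betw_def)


section \<open>The chain rule transformation\<close>

text \<open>The map \<phi>_x, named because naturality and associativity of \<gamma> both come down
  to identities between such maps.\<close>

definition chain_map :: "('u::set_universe, 'u) set_functor \<Rightarrow> 'u set \<Rightarrow> 'u \<Rightarrow> 'u \<Rightarrow> 'u" where
  "chain_map F A x = copair1 (Ob F A) (Ar F A (plus1 A) (inj1 A)) x"

lemma chain_map_hom:
  assumes "taut F" "small A" "x \<in> Ob (\<Delta> F) A"
  shows "chain_map F A x \<in> plus1 (Ob F A) \<rightarrow>\<^sub>E Ob F (plus1 A)"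
  unfolding chain_map_def using assms
  by (intro copair1_hom taut_Ar_inj1_hom) (auto simp: Ob_diff_functor)

lemma Src_chain_trans [simp]: "Src (\<gamma> G F) = (\<Delta> G \<circ>\<^sub>S F) \<times>\<^sub>S \<Delta> F"
  and Tgt_chain_trans [simp]: "Tgt (\<gamma> G F) = \<Delta> (G \<circ>\<^sub>S F)"
  by (simp_all add: chain_trans_def)

lemma Cmp_chain_trans:
  "Cmp (\<gamma> G F) A = (\<lambda>(y, x)\<in>Ob (\<Delta> G) (Ob F A) \<times> Ob (\<Delta> F) A.
    Ar G (plus1 (Ob F A)) (Ob F (plus1 A)) (chain_map F A x) y)"
  by (simp add: chain_trans_def chain_map_def)

text \<open>\<gamma> is well defined: if the value were G(F(j))(b), lifting along the square of
  \<open>is_pullback_copair1\<close> preserved by \<open>G\<close> would give a preimage of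
  \<open>y\<close> under G(j), impossible for \<open>y\<close> in \<Delta>[G](F(A)).\<close>

lemma chain_trans_mem:
  assumes F: "taut F" and G: "taut G" and A: "small A"
    and x: "x \<in> Ob (\<Delta> F) A" and y: "y \<in> Ob (\<Delta> G) (Ob F A)"
  shows "Ar G (plus1 (Ob F A)) (Ob F (plus1 A)) (chain_map F A x) y \<in> Ob (\<Delta> (G \<circ>\<^sub>S F)) A"
proof -
  let ?m = "Ar F A (plus1 A) (inj1 A)" and ?v = "Ar G (plus1 (Ob F A)) (Ob F (plus1 A)) (chain_map F A x) y"
  have m: "is_mono (Ob F A) (Ob F (plus1 A)) ?m"
    by (rule taut_mono[OF F is_mono_inj1[OF A]])
  have sm: "small (Ob F A)" "small (Ob F (plus1 A))"
    using A F by (auto intro: taut_small small_plus1)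
  have y': "y \<in> Ob G (plus1 (Ob F A))" using y by (simp add: Ob_diff_functor)
  have pb: "is_pullback (Ob F A) (plus1 (Ob F A)) (Ob F A) (Ob F (plus1 A))
      (inj1 (Ob F A)) (\<lambda>x\<in>Ob F A. x) (chain_map F A x) ?m"
    unfolding chain_map_def by (rule is_pullback_copair1[OF sm m]) (use x in \<open>simp add: Ob_diff_functor\<close>)
  have "?v \<noteq> Ar G (Ob F A) (Ob F (plus1 A)) ?m b" if "b \<in> Ob G (Ob F A)" for b
  proof
    assume "?v = Ar G (Ob F A) (Ob F (plus1 A)) ?m b"
    from is_pullback_lift[OF taut_pullback[OF G pb m] y' that this]
    show False using y by (auto simp: Ob_diff_functor)
  qed
  moreover have "?v \<in> Ob G (Ob F (plus1 A))"
    using sm y' by (intro functor_apply_mem taut_functor G small_plus1 chain_map_hom F A x)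
  ultimately show ?thesis by (auto simp: Ob_diff_functor)
qed

text \<open>Both sides are copairings on F(A) + 1. On F(A) they agree since (f + 1) j = j f and F is
  a functor; on the point, by the definition of \<Delta>[F](f).\<close>

lemma chain_map_natural:
  assumes F: "taut F" and AB: "small A" "small B" and f: "f \<in> A \<rightarrow>\<^sub>E B" and x: "x \<in> Ob (\<Delta> F) A"
  shows "compose (plus1 (Ob F A)) (Ar F (plus1 A) (plus1 B) (map_plus1 A B f)) (chain_map F A x)
    = compose (plus1 (Ob F A)) (chain_map F B (Ar (\<Delta> F) A B f x))
        (map_plus1 (Ob F A) (Ob F B) (Ar F A B f))"
proof -
  note fF = taut_functor[OF F]
  note sm = AB small_plus1[OF AB(1)] small_plus1[OF AB(2)]
  let ?f1 = "Ar F (plus1 A) (plus1 B) (map_plus1 A B f)" and ?x = "Ar (\<Delta> F) A B f x"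
  have x': "x \<in> Ob F (plus1 A)" and fx: "?x = ?f1 x"
    using x by (simp_all add: Ob_diff_functor Ar_diff_functor)
  have fx': "?x \<in> Ob F (plus1 B)"
    unfolding fx using diff_functor_mem[OF F AB f x] by (simp add: Ob_diff_functor)
  have "compose (Ob F A) ?f1 (Ar F A (plus1 A) (inj1 A))
      = Ar F A (plus1 B) (compose A (map_plus1 A B f) (inj1 A))"
    by (rule functor_compose[OF fF, symmetric]) (use sm f in \<open>simp_all add: inj1_hom map_plus1_hom\<close>)
  also have "\<dots> = Ar F A (plus1 B) (compose A (inj1 B) f)"
    by (simp only: map_plus1_inj1[OF f])
  also have "\<dots> = compose (Ob F A) (Ar F B (plus1 B) (inj1 B)) (Ar F A B f)"
    by (rule functor_compose[OF fF]) (use sm f in \<open>simp_all add: inj1_hom\<close>)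
  finally have eq: "compose (Ob F A) ?f1 (Ar F A (plus1 A) (inj1 A))
      = compose (Ob F A) (Ar F B (plus1 B) (inj1 B)) (Ar F A B f)" .
  have "compose (plus1 (Ob F A)) ?f1 (chain_map F A x)
      = copair1 (Ob F A) (compose (Ob F A) ?f1 (Ar F A (plus1 A) (inj1 A))) (?f1 x)"
    unfolding chain_map_def
    by (rule compose_copair1[OF taut_Ar_inj1_hom[OF F AB(1)] x' functor_hom[OF fF sm(3,4) map_plus1_hom[OF f]]])
  \<comment> \<open>Read backwards: precomposing with F f + 1 gives the copairing of F(j) F(f) with
    \<open>?x\<close>, and \<open>?x\<close> is \<open>?f1 x\<close>.\<close>
  also have "\<dots> = compose (plus1 (Ob F A)) (chain_map F B ?x) (map_plus1 (Ob F A) (Ob F B) (Ar F A B f))"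
    unfolding chain_map_def eq fx[symmetric]
    by (rule copair1_map_plus1[symmetric, OF functor_hom[OF fF AB f] taut_Ar_inj1_hom[OF F AB(2)] fx'])
  finally show ?thesis .
qed

lemma is_nat_trans_chain:
  assumes G: "taut G" and F: "taut F"
  shows "is_nat_trans (\<gamma> G F)"
proof (rule is_nat_transI)
  show "is_functor (Src (\<gamma> G F))" "is_functor (Tgt (\<gamma> G F))"
    using assms by (simp_all add: is_functor_prod is_functor_comp is_functor_diff taut_endofunctor taut_comp)
  show "Cmp (\<gamma> G F) A \<in> Ob (Src (\<gamma> G F)) A \<rightarrow>\<^sub>E Ob (Tgt (\<gamma> G F)) A" if "small A" for A
    using chain_trans_mem[OF F G that] by (auto simp: Cmp_chain_trans)
next
  fix A B :: "'a set" and f a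
  assume AB: "small A" "small B" and f: "f \<in> A \<rightarrow>\<^sub>E B" and "a \<in> Ob (Src (\<gamma> G F)) A"
  then obtain y x where a: "a = (y, x)" and y: "y \<in> Ob (\<Delta> G) (Ob F A)" and x: "x \<in> Ob (\<Delta> F) A"
    by auto
  note fF = taut_functor[OF F] and fG = taut_functor[OF G]
  note sm = AB small_plus1[OF AB(1)] small_plus1[OF AB(2)]
  note smF = sm[THEN taut_small[OF F]]
  note sm1F = smF[THEN small_plus1]
  have y': "y \<in> Ob G (plus1 (Ob F A))" using y by (simp add: Ob_diff_functor)
  have Ff: "Ar F A B f \<in> Ob F A \<rightarrow>\<^sub>E Ob F B" by (rule functor_hom[OF fF AB f])
  let ?x = "Ar (\<Delta> F) A B f x" and ?y = "Ar (\<Delta> G) (Ob F A) (Ob F B) (Ar F A B f) y"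
  have x1: "?x \<in> Ob (\<Delta> F) B"
    by (rule functor_apply_mem[OF is_functor_diff[OF F] AB f x])
  have y1: "?y \<in> Ob (\<Delta> G) (Ob F B)"
    by (rule functor_apply_mem[OF is_functor_diff[OF G] smF(1,2) Ff y])
  have "Cmp (\<gamma> G F) B (Ar (Src (\<gamma> G F)) A B f a)
      = Ar G (plus1 (Ob F B)) (Ob F (plus1 B)) (chain_map F B ?x)
          (Ar G (plus1 (Ob F A)) (plus1 (Ob F B)) (map_plus1 (Ob F A) (Ob F B) (Ar F A B f)) y)"
    using x y x1 y1 by (simp add: a Cmp_chain_trans Ar_diff_functor)
  \<comment> \<open>The two arrows are merged under a single \<open>G\<close>, so that
    \<open>chain_map_natural\<close> can be substituted in its argument; they are then split
    again.\<close>
  also have "\<dots> = Ar G (plus1 (Ob F A)) (Ob F (plus1 B))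
      (compose (plus1 (Ob F A)) (chain_map F B ?x) (map_plus1 (Ob F A) (Ob F B) (Ar F A B f))) y"
    by (rule functor_compose_apply[OF fG sm1F(1,2) smF(4) map_plus1_hom[OF Ff]
        chain_map_hom[OF F AB(2) x1] y'])
  also have "\<dots> = Ar G (plus1 (Ob F A)) (Ob F (plus1 B))
      (compose (plus1 (Ob F A)) (Ar F (plus1 A) (plus1 B) (map_plus1 A B f)) (chain_map F A x)) y"
    by (simp only: chain_map_natural[OF F AB f x])
  also have "\<dots> = Ar G (Ob F (plus1 A)) (Ob F (plus1 B)) (Ar F (plus1 A) (plus1 B) (map_plus1 A B f))
      (Ar G (plus1 (Ob F A)) (Ob F (plus1 A)) (chain_map F A x) y)"
    by (rule functor_compose_apply[symmetric, OF fG sm1F(1) smF(3,4) chain_map_hom[OF F AB(1) x]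
        functor_hom[OF fF sm(3,4) map_plus1_hom[OF f]] y'])
  \<comment> \<open>The arrow part of \<Delta>[G F] is a restriction, so evaluating it requires that
    the value of \<gamma> lies in \<Delta>[G F](A).\<close>
  also have "\<dots> = Ar (Tgt (\<gamma> G F)) A B f (Cmp (\<gamma> G F) A a)"
    using x y chain_trans_mem[OF F G AB(1) x y] by (simp add: a Cmp_chain_trans Ar_diff_functor)
  finally show "Cmp (\<gamma> G F) B (Ar (Src (\<gamma> G F)) A B f a) = Ar (Tgt (\<gamma> G F)) A B f (Cmp (\<gamma> G F) A a)" .
qed

section \<open>Associativity\<close>

text \<open>Since F(j) = \<phi>_x j, also G(F(j)) = G(\<phi>_x) G(j). Both entries of the copairing
  on the left thus have the factor G(\<phi>_x), which can be pulled out.\<close>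

lemma chain_map_comp:
  assumes F: "taut F" and G: "taut G" and A: "small A"
    and x: "x \<in> Ob (\<Delta> F) A" and y: "y \<in> Ob (\<Delta> G) (Ob F A)"
  shows "chain_map (G \<circ>\<^sub>S F) A (Ar G (plus1 (Ob F A)) (Ob F (plus1 A)) (chain_map F A x) y)
    = compose (plus1 (Ob G (Ob F A)))
        (Ar G (plus1 (Ob F A)) (Ob F (plus1 A)) (chain_map F A x)) (chain_map G (Ob F A) y)"
proof -
  note fG = taut_functor[OF G]
  have sm: "small (Ob F A)" "small (plus1 (Ob F A))" "small (Ob F (plus1 A))"
    using A F by (auto intro: taut_small small_plus1)
  have y': "y \<in> Ob G (plus1 (Ob F A))" using y by (simp add: Ob_diff_functor)
  note phi = chain_map_hom[OF F A x]
  have "Ar F A (plus1 A) (inj1 A) = compose (Ob F A) (chain_map F A x) (inj1 (Ob F A))"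
    unfolding chain_map_def by (rule copair1_inj1[symmetric, OF taut_Ar_inj1_hom[OF F A]])
  then have eq: "Ar (G \<circ>\<^sub>S F) A (plus1 A) (inj1 A)
      = compose (Ob G (Ob F A)) (Ar G (plus1 (Ob F A)) (Ob F (plus1 A)) (chain_map F A x))
          (Ar G (Ob F A) (plus1 (Ob F A)) (inj1 (Ob F A)))"
    by (simp add: functor_compose[OF fG sm inj1_hom phi])
  show ?thesis
    unfolding chain_map_def[of "G \<circ>\<^sub>S F"] chain_map_def[of G] eq Ob_comp_functor
    by (rule compose_copair1[symmetric, OF taut_Ar_inj1_hom[OF G sm(1)] y' functor_hom[OF fG sm(2,3) phi]])
qed

text \<open>At (z, y, x) the left side applies H to the map of \<open>chain_map_comp\<close>, while
  the right side applies H to its two factors in turn; functoriality of H joins them.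
  \<open>assoc_trans\<close> is there because HOL pairs nest to the right.\<close>

lemma chain_trans_assoc:
  assumes F: "taut F" and G: "taut G" and H: "taut H"
  shows "\<gamma> H (G \<circ>\<^sub>S F) \<cdot> (id_trans (\<Delta> H \<circ>\<^sub>S G \<circ>\<^sub>S F) \<times>\<^sub>T \<gamma> G F)
    \<approx> \<gamma> (H \<circ>\<^sub>S G) F \<cdot> ((\<gamma> H G \<circ>\<^sub>W F) \<times>\<^sub>T id_trans (\<Delta> F))
        \<cdot> assoc_trans (\<Delta> H \<circ>\<^sub>S G \<circ>\<^sub>S F) (\<Delta> G \<circ>\<^sub>S F) (\<Delta> F)"
    (is "?L \<approx> ?R")
proof -
  note GF = taut_comp[OF G F] and HG = taut_comp[OF H G]
  have K: "is_functor (\<Delta> H \<circ>\<^sub>S G \<circ>\<^sub>S F)" "is_functor (\<Delta> G \<circ>\<^sub>S F)" "is_functor (\<Delta> F)"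
    using assms by (auto intro: is_functor_comp is_functor_diff taut_endofunctor)
  have L: "is_nat_trans ?L"
    by (intro is_nat_trans_comp is_nat_trans_prod is_nat_trans_id is_nat_trans_chain K GF G F H)
      (simp add: prod_trans_def id_trans_def comp_functor_assoc)
  have R: "is_nat_trans ?R"
    by (intro is_nat_trans_comp is_nat_trans_prod is_nat_trans_id is_nat_trans_chain
        is_nat_trans_whisker is_nat_trans_assoc taut_endofunctor K HG G F H)
      (simp_all add: prod_trans_def id_trans_def whisker_def assoc_trans_def comp_trans_def
        prod_functor_def comp_functor_def)
  have Src: "Src ?L = Src ?R" and Tgt: "Tgt ?L = Tgt ?R"
    by (simp_all add: prod_trans_def id_trans_def assoc_trans_def comp_trans_def comp_functor_assoc)
  have "Cmp ?L A = Cmp ?R A" if A: "small A" for A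
  \<comment> \<open>Components are extensional on the common source, so comparing them on triples is
    enough.\<close>
  proof (rule PiE_ext[OF nat_trans_hom[OF L A] nat_trans_hom[OF R A, folded Src Tgt]])
    fix w assume "w \<in> Ob (Src ?L) A"
    then obtain z y x where w: "w = (z, y, x)" and z: "z \<in> Ob (\<Delta> H) (Ob G (Ob F A))"
      and y: "y \<in> Ob (\<Delta> G) (Ob F A)" and x: "x \<in> Ob (\<Delta> F) A"
      by (auto simp: comp_trans_def prod_trans_def id_trans_def)
    have FA: "small (Ob F A)" using F A by (rule taut_small)
    have sm: "small (plus1 (Ob G (Ob F A)))" "small (Ob G (plus1 (Ob F A)))"
        "small (Ob G (Ob F (plus1 A)))" "small (plus1 (Ob F A))" "small (Ob F (plus1 A))"
      using A F G by (auto intro: taut_small small_plus1)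
    have z': "z \<in> Ob H (plus1 (Ob G (Ob F A)))" using z by (simp add: Ob_diff_functor)
    let ?phi = "Ar G (plus1 (Ob F A)) (Ob F (plus1 A)) (chain_map F A x)"
    let ?z = "Ar H (plus1 (Ob G (Ob F A))) (Ob G (plus1 (Ob F A))) (chain_map G (Ob F A) y) z"
    \<comment> \<open>The inner values must lie in the domains of the outer components:
      \<open>mem1\<close> serves the left composite, \<open>mem2\<close> the right one.\<close>
    note mem1 = chain_trans_mem[OF F G A x y] and mem2 = chain_trans_mem[OF G H FA y z]
    have phi: "?phi \<in> Ob G (plus1 (Ob F A)) \<rightarrow>\<^sub>E Ob G (Ob F (plus1 A))"
      by (rule functor_hom[OF taut_functor[OF G] sm(4,5) chain_map_hom[OF F A x]])
    have "Cmp ?L A w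
        = Ar H (plus1 (Ob G (Ob F A))) (Ob G (Ob F (plus1 A))) (chain_map (G \<circ>\<^sub>S F) A (?phi y)) z"
      using x y z mem1
      by (simp add: w comp_trans_def prod_trans_def id_trans_def compose_eq Cmp_chain_trans)
    also have "\<dots> = Ar H (Ob G (plus1 (Ob F A))) (Ob G (Ob F (plus1 A))) ?phi ?z"
      unfolding chain_map_comp[OF F G A x y]
      by (rule functor_compose_apply[symmetric, OF taut_functor[OF H] sm(1-3)
          chain_map_hom[OF G FA y] phi z'])
    also have "\<dots> = Cmp ?R A w"
      using x y z mem2
      by (simp add: w comp_trans_def prod_trans_def id_trans_def assoc_trans_def whisker_def
          compose_eq Cmp_chain_trans)
    finally show "Cmp ?L A w = Cmp ?R A w" .
  qed
  with L R Src Tgt show ?thesis by (simp add: eq_trans_def)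
qed

section \<open>Unit laws\<close>

text \<open>With G = Id the component only evaluates \<phi>_x, and at \<open>pt\<close> this gives
  the second entry of the copairing.\<close>

lemma chain_trans_id_left_apply:
  assumes "x \<in> Ob (\<Delta> F) A"
  shows "Cmp (\<gamma> id_functor F) A (pt, x) = x"
  using assms by (simp add: Cmp_chain_trans chain_map_def)

text \<open>For the identity functor \<phi>_x at x = \<open>pt\<close> is [j, pt], the identity of A
  + 1, and F preserves identities.\<close>

lemma chain_trans_id_right_apply:
  assumes F: "taut F" and A: "small A" and y: "y \<in> Ob (\<Delta> F) A"
  shows "Cmp (\<gamma> F id_functor) A (y, pt) = y"
proof -
  have "chain_map id_functor A pt = (\<lambda>w\<in>plus1 A. w)"
  proof (rule plus1_hom_eqI[OF _ id_hom])
    show "chain_map id_functor A pt \<in> plus1 A \<rightarrow>\<^sub>E plus1 A"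
      using chain_map_hom[OF taut_id A] by simp
  qed (simp_all add: chain_map_def)
  with y show ?thesis
    by (simp add: Cmp_chain_trans functor_id[OF taut_functor[OF F] small_plus1[OF A]])
      (simp add: Ob_diff_functor)
qed

lemma is_nat_iso_chain_id_left:
  assumes F: "taut F"
  shows "is_nat_iso (\<gamma> id_functor F)"
proof -
  have "bij_betw (Cmp (\<gamma> id_functor F) A) ({pt} \<times> Ob (\<Delta> F) A) (Ob (\<Delta> F) A)" for A
    \<comment> \<open>The inverse pairs an element with \<open>pt\<close>, the only element of
      \<Delta>[Id](F(A)).\<close>
    by (rule bij_betw_byWitness[where f' = "Pair pt"]) (auto simp: chain_trans_id_left_apply)
  then show ?thesis
    using is_nat_trans_chain[OF taut_id F] by (simp add: is_nat_iso_def)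
qed

lemma is_nat_iso_chain_id_right:
  assumes F: "taut F"
  shows "is_nat_iso (\<gamma> F id_functor)"
proof -
  have "bij_betw (Cmp (\<gamma> F id_functor) A) (Ob (\<Delta> F) A \<times> {pt}) (Ob (\<Delta> F) A)" if "small A" for A
    by (rule bij_betw_byWitness[where f' = "\<lambda>y. (y, pt)"])
      (auto simp: chain_trans_id_right_apply[OF F that])
  then show ?thesis
    using is_nat_trans_chain[OF F taut_id] by (simp add: is_nat_iso_def)
qed

lemma chain_trans_id_left:
  assumes F: "taut F"
  shows "\<gamma> id_functor F
    \<approx> left_unit_trans (\<Delta> F) \<cdot> ((diff_id_trans \<circ>\<^sub>W F) \<times>\<^sub>T id_trans (\<Delta> F))" (is "?L \<approx> ?R")
proof -
  have L: "is_nat_trans ?L" by (rule is_nat_trans_chain[OF taut_id F])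
  have R: "is_nat_trans ?R"
    by (intro is_nat_trans_comp is_nat_trans_prod is_nat_trans_id is_nat_trans_whisker is_nat_trans_diff_id
        is_nat_trans_left_unit is_functor_diff taut_endofunctor F)
      \<comment> \<open>The middle functors match because a constant functor absorbs precomposition:
        \<open>one_functor \<circ>\<^sub>S F\<close> is \<open>one_functor\<close>.\<close>
      (simp add: prod_trans_def whisker_def id_trans_def left_unit_trans_def diff_id_trans_def
        one_functor_def comp_functor_def)
  have Src: "Src ?L = Src ?R" and Tgt: "Tgt ?L = Tgt ?R"
    by (simp_all add: comp_trans_def prod_trans_def whisker_def id_trans_def left_unit_trans_def
        diff_id_trans_def)
  have "Cmp ?L A = Cmp ?R A" if A: "small A" for A
    by (rule PiE_ext[OF nat_trans_hom[OF L A] nat_trans_hom[OF R A, folded Src Tgt]])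
      (auto simp: chain_trans_id_left_apply comp_trans_def prod_trans_def whisker_def id_trans_def
        left_unit_trans_def diff_id_trans_def compose_eq)
  with L R Src Tgt show ?thesis by (simp add: eq_trans_def)
qed

lemma chain_trans_id_right:
  assumes F: "taut F"
  shows "\<gamma> F id_functor
    \<approx> right_unit_trans (\<Delta> F) \<cdot> (id_trans (\<Delta> F \<circ>\<^sub>S id_functor) \<times>\<^sub>T diff_id_trans)" (is "?L \<approx> ?R")
proof -
  have L: "is_nat_trans ?L" by (rule is_nat_trans_chain[OF F taut_id])
  have R: "is_nat_trans ?R"
    \<comment> \<open>Composition with the identity functor is strictly unital on records, so the
      middle functors match without a further coercion.\<close>
    unfolding comp_functor_id
    by (intro is_nat_trans_comp is_nat_trans_prod is_nat_trans_id is_nat_trans_diff_id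
        is_nat_trans_right_unit is_functor_diff F)
      (simp add: prod_trans_def id_trans_def right_unit_trans_def diff_id_trans_def)
  have Src: "Src ?L = Src ?R" and Tgt: "Tgt ?L = Tgt ?R"
    by (simp_all add: comp_trans_def prod_trans_def id_trans_def right_unit_trans_def
        diff_id_trans_def)
  have "Cmp ?L A = Cmp ?R A" if A: "small A" for A
    by (rule PiE_ext[OF nat_trans_hom[OF L A] nat_trans_hom[OF R A, folded Src Tgt]])
      (auto simp: chain_trans_id_right_apply[OF F A] comp_trans_def prod_trans_def id_trans_def
        right_unit_trans_def diff_id_trans_def compose_eq)
  with L R Src Tgt show ?thesis by (simp add: eq_trans_def)
qed

text \<open>The conjunct on \<open>diff_id_trans\<close> justifies the identification \<Delta>[Id] =
  1 through which both unit laws are phrased.\<close>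

theorem theorem3p3p3:
  fixes F G H :: "('u::set_universe, 'u) set_functor"
  assumes "taut F" and "taut G" and "taut H"
  shows
    "(\<gamma> H (G \<circ>\<^sub>S F) \<cdot> (id_trans (\<Delta> H \<circ>\<^sub>S G \<circ>\<^sub>S F) \<times>\<^sub>T \<gamma> G F)
        \<approx> \<gamma> (H \<circ>\<^sub>S G) F \<cdot> ((\<gamma> H G \<circ>\<^sub>W F) \<times>\<^sub>T id_trans (\<Delta> F))
            \<cdot> assoc_trans (\<Delta> H \<circ>\<^sub>S G \<circ>\<^sub>S F) (\<Delta> G \<circ>\<^sub>S F) (\<Delta> F))
     \<and> is_nat_iso (diff_id_trans :: ('u, 'u, unit) transformation)
     \<and> (is_nat_iso (\<gamma> id_functor F) \<and>
        \<gamma> id_functor F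
        \<approx> left_unit_trans (\<Delta> F) \<cdot> ((diff_id_trans \<circ>\<^sub>W F) \<times>\<^sub>T id_trans (\<Delta> F)))
     \<and> (is_nat_iso (\<gamma> F id_functor) \<and>
        \<gamma> F id_functor
        \<approx> right_unit_trans (\<Delta> F) \<cdot> (id_trans (\<Delta> F \<circ>\<^sub>S id_functor) \<times>\<^sub>T diff_id_trans))"
  using assms
  by (intro conjI chain_trans_assoc is_nat_iso_diff_id is_nat_iso_chain_id_left chain_trans_id_left
      is_nat_iso_chain_id_right chain_trans_id_right)

end
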